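(* Let $\lambda$ be a countable limit ordinal. The class $\mathbf\Delta^0_\lambda$ of subsets of Baire space $\omega^\omega$ is the smallest collection of subsets of $\omega^\omega$ which: (1) contains $\mathbf\Sigma^0_\xi$ for all $\xi<\lambda$; and (2) is closed under unions of $\mathbf\Sigma^0_\xi$-separated sequences, for all $\xi<\lambda$ (i.e., if $(A_n)_{n\in\omega}$ is a sequence of members of the collection which is $\mathbf\Sigma^0_\xi$-separated for some $\xi<\lambda$, then $\bigcup_n A_n$ is in the collection).
   Context: $\mathbf\Sigma^0_\xi$ ($1\le\xi<\omega_1$) and $\mathbf\Delta^0_\lambda$ are the usual boldface Borel classes of subsets of Baire space $\omega^\omega$. A countable sequence of sets $(A_n)_{n\in\omega}$ is $\mathbf\Sigma^0_\xi$-separated if there is a sequence $(U_n)_{n\in\omega}$ of pairwise disjoint $\mathbf\Sigma^0_\xi$ sets with $A_n\subseteq U_n$ for all $n$. *)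

theory Defs
  imports "HOL-Analysis.Function_Topology" "HOL-Library.Countable_Set_Type" "HOL-Library.Disjoint_Sets"
begin

section \<open>Countable ordinals\<close>

text \<open>
  The type \<open>omega1\<close> is the ordinal \<open>\<omega>\<^sub>1\<close>, realised as the successor cardinal of \<open>\<omega>\<close>; its
  elements are the countable ordinals, a point \<open>x\<close> standing for the order type of \<open>{..<x}\<close>.
  The lemmas \<open>countable_below_omega1\<close> and \<open>uncountable_omega1\<close> below confirm that this
  well-ordered type is \<open>\<omega>\<^sub>1\<close>.
\<close>

typedef omega1 = "Field (cardSuc natLeq)"
proof -
  have "\<not> finite (Field (cardSuc natLeq))"
    using cardSuc_finite[OF natLeq_Card_order] Field_natLeq by simp
  then show ?thesis by (metis all_not_in_conv finite.emptyI)
qed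

lemma Well_order_cardSuc_natLeq: "Well_order (cardSuc natLeq)"
  using cardSuc_Card_order[OF natLeq_Card_order] by (simp add: card_order_on_def)

instantiation omega1 :: wellorder
begin

definition less_eq_omega1 :: "omega1 \<Rightarrow> omega1 \<Rightarrow> bool" where
  "x \<le> y \<longleftrightarrow> (Rep_omega1 x, Rep_omega1 y) \<in> cardSuc natLeq"

definition less_omega1 :: "omega1 \<Rightarrow> omega1 \<Rightarrow> bool" where
  "x < y \<longleftrightarrow> x \<le> y \<and> x \<noteq> (y::omega1)"

instance
proof
  note W = Well_order_cardSuc_natLeq[unfolded well_order_on_def linear_order_on_def
      partial_order_on_def preorder_on_def]
  fix x y z :: omega1
  show refl: "x \<le> x"
    using W Rep_omega1 by (auto simp: less_eq_omega1_def refl_on_def)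
  show "x \<le> y \<Longrightarrow> y \<le> z \<Longrightarrow> x \<le> z"
    using W unfolding less_eq_omega1_def by (meson transD)
  show anti: "x \<le> y \<Longrightarrow> y \<le> x \<Longrightarrow> x = y" for x y :: omega1
    using W unfolding less_eq_omega1_def by (metis antisymD Rep_omega1_inject)
  show "x < y \<longleftrightarrow> x \<le> y \<and> \<not> y \<le> x"
    using anti refl by (auto simp: less_omega1_def)
  show "x \<le> y \<or> y \<le> x"
  proof (cases "x = y")
    case True
    then show ?thesis using refl by simp
  next
    case False
    then show ?thesis
      using W Rep_omega1[of x] Rep_omega1[of y]
      unfolding less_eq_omega1_def total_on_def by (metis Rep_omega1_inject)
  qed
next
  fix P :: "omega1 \<Rightarrow> bool" and a
  assume step: "\<And>x. (\<And>y. y < x \<Longrightarrow> P y) \<Longrightarrow> P x"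
  have "wf (inv_image (cardSuc natLeq - Id) Rep_omega1)"
    using Well_order_cardSuc_natLeq by (simp add: well_order_on_def wf_inv_image)
  then show "P a"
  proof (induction a rule: wf_induct_rule)
    case (less x)
    show ?case
      by (rule step, rule less)
        (auto simp: less_omega1_def less_eq_omega1_def in_inv_image Rep_omega1_inject)
  qed
qed

end

context includes cardinal_syntax
begin

lemma countable_below_omega1: "countable {..<x::omega1}"
proof -
  let ?r = "cardSuc natLeq"
  have "|underS ?r (Rep_omega1 x)| <o ?r"
    using card_of_underS[OF cardSuc_Card_order[OF natLeq_Card_order] Rep_omega1] .
  then have "|underS ?r (Rep_omega1 x)| \<le>o natLeq"
    by (simp only: cardSuc_ordLeq_ordLess[OF natLeq_Card_order card_of_Card_order])
  then have "countable (underS ?r (Rep_omega1 x))"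
    by (simp add: countable_card_le_natLeq)
  moreover have "Rep_omega1 ` {..<x} \<subseteq> underS ?r (Rep_omega1 x)"
    by (auto simp: underS_def less_omega1_def less_eq_omega1_def Rep_omega1_inject)
  ultimately have "countable (Rep_omega1 ` {..<x})"
    using countable_subset by blast
  then show ?thesis
    by (meson countable_image_inj_on inj_on_def Rep_omega1_inject)
qed

lemma uncountable_omega1: "\<not> countable (UNIV :: omega1 set)"
proof
  assume "countable (UNIV :: omega1 set)"
  then have "countable (range Rep_omega1)" by simp
  then have "countable (Field (cardSuc natLeq))"
    by (simp add: type_definition.Rep_range[OF type_definition_omega1])
  then have "|Field (cardSuc natLeq)| \<le>o natLeq"
    by (simp add: countable_card_le_natLeq)
  moreover have "|Field (cardSuc natLeq)| =o cardSuc natLeq"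
    using card_of_Field_ordIso[OF cardSuc_Card_order[OF natLeq_Card_order]] .
  ultimately have "cardSuc natLeq \<le>o natLeq"
    using ordIso_ordLeq_trans ordIso_symmetric by blast
  then show False
    using cardSuc_greater[OF natLeq_Card_order] not_ordLess_ordLeq by blast
qed

end

instantiation omega1 :: "{zero, one}"
begin

definition zero_omega1 :: omega1 where "0 = (LEAST x::omega1. True)"

definition one_omega1 :: omega1 where "1 = (LEAST x::omega1. 0 < x)"

instance ..

end

lemma omega1_zero_le: "0 \<le> (x::omega1)"
  by (simp add: zero_omega1_def Least_le)

lemma omega1_zero_less_one: "0 < (1::omega1)"
proof -
  have "\<exists>x::omega1. 0 < x"
  proof (rule ccontr)
    assume "\<nexists>x::omega1. 0 < x"
    then have "(UNIV :: omega1 set) = {0}"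
      using omega1_zero_le by (auto simp: less_le)
    then show False
      using uncountable_omega1 by (metis countable_empty countable_insert)
  qed
  then show ?thesis unfolding one_omega1_def by (rule LeastI_ex)
qed

lemma omega1_one_le_iff: "1 \<le> (x::omega1) \<longleftrightarrow> 0 < x"
  using omega1_zero_less_one by (auto simp: one_omega1_def intro: Least_le)

definition limit_ordinal :: "omega1 \<Rightarrow> bool" where
  "limit_ordinal l \<longleftrightarrow> l \<noteq> 0 \<and> (\<forall>x<l. \<exists>y<l. x < y)"


section \<open>The Borel hierarchy\<close>

text \<open>
  The recursion in the form appropriate to metrizable spaces: \<open>\<Sigma>\<^sup>0\<^sub>1\<close> is the class of open sets,
  and for \<open>\<xi> > 1\<close> the class \<open>\<Sigma>\<^sup>0\<^sub>\<xi>\<close> consists of the countable unions of sets each of which is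
  \<open>\<Pi>\<^sup>0\<^sub>\<eta>\<close>, i.e. has a \<open>\<Sigma>\<^sup>0\<^sub>\<eta>\<close> complement, for some \<open>1 \<le> \<eta> < \<xi>\<close>. No set is \<open>\<Sigma>\<^sup>0\<^sub>0\<close>.
\<close>

inductive is_Sigma0 :: "omega1 \<Rightarrow> 'a::topological_space set \<Rightarrow> bool" where
  base: "open U \<Longrightarrow> is_Sigma0 1 U"
| union: "1 < \<xi> \<Longrightarrow> (\<And>n::nat. 1 \<le> \<eta> n \<and> \<eta> n < \<xi> \<and> is_Sigma0 (\<eta> n) (- A n))
    \<Longrightarrow> is_Sigma0 \<xi> (\<Union>n. A n)"

definition Sigma0 :: "omega1 \<Rightarrow> 'a::topological_space set set" where
  "Sigma0 \<xi> = {A. is_Sigma0 \<xi> A}"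

definition Pi0 :: "omega1 \<Rightarrow> 'a::topological_space set set" where
  "Pi0 \<xi> = {A. - A \<in> Sigma0 \<xi>}"

definition Delta0 :: "omega1 \<Rightarrow> 'a::topological_space set set" where
  "Delta0 \<xi> = Sigma0 \<xi> \<inter> Pi0 \<xi>"

definition Sigma0_separated :: "omega1 \<Rightarrow> (nat \<Rightarrow> 'a::topological_space set) \<Rightarrow> bool" where
  "Sigma0_separated \<xi> A \<longleftrightarrow>
    (\<exists>U. (\<forall>n. U n \<in> Sigma0 \<xi>) \<and> disjoint_family U \<and> (\<forall>n. A n \<subseteq> U n))"

definition closed_under_separated_unions :: "omega1 \<Rightarrow> 'a::topological_space set set \<Rightarrow> bool" where
  "closed_under_separated_unions \<xi> C \<longleftrightarrow>
    (\<forall>A :: nat \<Rightarrow> 'a set. (\<forall>n. A n \<in> C) \<and> Sigma0_separated \<xi> A \<longrightarrow> (\<Union>n. A n) \<in> C)"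

definition separated_union_family :: "omega1 \<Rightarrow> 'a::topological_space set set \<Rightarrow> bool" where
  "separated_union_family l C \<longleftrightarrow>
    (\<forall>\<xi>. 1 \<le> \<xi> \<and> \<xi> < l \<longrightarrow> Sigma0 \<xi> \<subseteq> C) \<and>
    (\<forall>\<xi>. 1 \<le> \<xi> \<and> \<xi> < l \<longrightarrow> closed_under_separated_unions \<xi> C)"

text \<open>
  Baire space \<open>\<omega>\<^sup>\<omega>\<close>: the topology on functions is the library's product topology, and that on
  \<^typ>\<open>nat\<close> is discrete.
\<close>

type_synonym baire = "nat \<Rightarrow> nat"

end

theory Submission
  imports Defs
begin

text \<open>
  Let \<open>A \<in> \<Delta>\<^sup>0\<^sub>\<lambda>\<close> and let \<open>C\<close> be a collection with the two closure properties. Call a set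
  \<open>p\<close> that is \<open>\<Delta>\<^sup>0\<^sub>\<xi>\<close> for some \<open>\<xi> < \<lambda>\<close> good if \<open>A \<inter> W \<in> C\<close> for all such sets \<open>W \<subseteq> p\<close>. If \<open>p\<close> is
  covered by sets \<open>q j\<close> that are all \<open>\<Delta>\<^sup>0\<^sub>\<xi>\<close> for one \<open>\<xi> < \<lambda>\<close>, and every \<open>p \<inter> q j\<close> is good, then \<open>p\<close> is
  good: disjointify the cover and use closure under separated unions. So, if the whole space were
  not good, one could choose a decreasing sequence of sets that are not good which enters each of
  countably many prescribed covers. As in a forcing argument, such a generic sequence
  determines a point \<open>x\<close>, and membership of \<open>x\<close> in any of countably many given Borel sets is decided
  by a term of the sequence. Apply this to the \<open>\<Pi>\<^sup>0\<^sub>\<eta>\<close> pieces (\<open>\<eta> < \<lambda>\<close>) of \<open>A\<close> and of \<open>- A\<close>: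
  some term is contained in \<open>A\<close> or in \<open>- A\<close>, and hence is good.
\<close>

section \<open>Closure properties of the Borel classes\<close>

definition cylinder :: "baire \<Rightarrow> nat \<Rightarrow> baire set" where
  "cylinder x n = {y. \<forall>i<n. y i = x i}"

lemma mem_cylinder: "x \<in> cylinder x n"
  by (simp add: cylinder_def)

lemma clopen_coordinate: "open {y::baire. y i \<in> X}" "closed {y::baire. y i \<in> X}"
proof -
  show "open {y::baire. y i \<in> X}" for X
    using product_topology_basis'[of "{i}" "\<lambda>_. X" id] by (simp add: open_discrete)
  from this[of "- X"] show "closed {y::baire. y i \<in> X}"
    by (simp add: closed_def Compl_eq)
qed

lemma clopen_cylinder: "open (cylinder x n)" "closed (cylinder x n)"
proof -
  have "cylinder x n = (\<Inter>i\<in>{..<n}. {y. y i \<in> {x i}})"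
    by (auto simp: cylinder_def)
  then show "open (cylinder x n)" "closed (cylinder x n)"
    by (simp_all only: open_INT closed_INT finite_lessThan clopen_coordinate ball_simps simp_thms
        Ball_def)
qed

lemma open_contains_cylinder:
  assumes "open U" "x \<in> U"
  obtains n where "cylinder x n \<subseteq> U"
proof -
  from product_topology_open_contains_basis[OF assms(1)[unfolded open_fun_def] assms(2)]
  obtain X where X: "x \<in> (\<Pi>\<^sub>E i\<in>UNIV. X i)" "finite {i. X i \<noteq> UNIV}" "(\<Pi>\<^sub>E i\<in>UNIV. X i) \<subseteq> U"
    by auto
  obtain n where n: "\<And>i. X i \<noteq> UNIV \<Longrightarrow> i < n"
    using X(2) by (auto simp: finite_nat_set_iff_bounded)
  have "cylinder x n \<subseteq> (\<Pi>\<^sub>E i\<in>UNIV. X i)"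
  proof
    fix y assume "y \<in> cylinder x n"
    then have "y i \<in> X i" for i
      using X(1) n[of i] by (cases "i < n") (auto simp: cylinder_def PiE_iff)
    then show "y \<in> (\<Pi>\<^sub>E i\<in>UNIV. X i)" by (simp add: PiE_iff)
  qed
  from that[OF order_trans[OF this X(3)]] show ?thesis .
qed

lemma open_eq_UN_clopen:
  fixes S :: "baire set"
  assumes "open S"
  obtains c :: "nat \<Rightarrow> baire set" where "\<And>n. open (c n)" "\<And>n. closed (c n)" "S = (\<Union>n. c n)"
proof
  define cyl :: "nat list \<Rightarrow> baire set" where "cyl s = cylinder ((!) s) (length s)" for s
  \<comment> \<open>\<open>from_nat\<close> runs through all finite sequences. Those whose cylinder
    is not inside \<open>S\<close> contribute \<open>{}\<close>, so that \<open>c\<close> is total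
    on \<open>nat\<close>.\<close>
  define c where "c n = (if cyl (from_nat n) \<subseteq> S then cyl (from_nat n) else {})" for n
  show "open (c n)" "closed (c n)" for n
    by (simp_all add: c_def cyl_def clopen_cylinder)
  show "S = (\<Union>n. c n)"
  proof
    show "S \<subseteq> (\<Union>n. c n)"
    proof
      fix x assume "x \<in> S"
      then obtain n where n: "cylinder x n \<subseteq> S"
        using open_contains_cylinder assms by blast
      have "cyl (map x [0..<n]) = cylinder x n"
        by (auto simp: cyl_def cylinder_def)
      then have "c (to_nat (map x [0..<n])) = cylinder x n"
        using n by (simp add: c_def)
      then show "x \<in> (\<Union>n. c n)"
        using mem_cylinder by blast
    qed
  qed (auto simp: c_def split: if_splits)
qed

section \<open>Levels of the Borel hierarchy\<close>

lemma Sigma0_1: "(Sigma0 1 :: 'a::topological_space set set) = Collect open"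
proof -
  have "is_Sigma0 1 U \<longleftrightarrow> open U" for U :: "'a set"
    using is_Sigma0.cases[of 1 U] is_Sigma0.base by blast
  then show ?thesis by (simp add: Sigma0_def)
qed

lemma Sigma0_iff:
  assumes "1 < \<xi>"
  shows "A \<in> Sigma0 \<xi> \<longleftrightarrow>
    (\<exists>B. A = (\<Union>n::nat. B n) \<and> (\<forall>n. \<exists>\<eta>. 1 \<le> \<eta> \<and> \<eta> < \<xi> \<and> - B n \<in> Sigma0 \<eta>))"
proof
  assume "A \<in> Sigma0 \<xi>"
  then have "is_Sigma0 \<xi> A" by (simp add: Sigma0_def)
  then show "\<exists>B. A = (\<Union>n::nat. B n) \<and> (\<forall>n. \<exists>\<eta>. 1 \<le> \<eta> \<and> \<eta> < \<xi> \<and> - B n \<in> Sigma0 \<eta>)"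
    using assms by cases (auto simp: Sigma0_def)
next
  assume "\<exists>B. A = (\<Union>n::nat. B n) \<and> (\<forall>n. \<exists>\<eta>. 1 \<le> \<eta> \<and> \<eta> < \<xi> \<and> - B n \<in> Sigma0 \<eta>)"
  then obtain B \<eta> where "A = (\<Union>n::nat. B n)" "\<forall>n. 1 \<le> \<eta> n \<and> \<eta> n < \<xi> \<and> - B n \<in> Sigma0 (\<eta> n)"
    by metis
  then show "A \<in> Sigma0 \<xi>"
    using is_Sigma0.union[OF assms, of \<eta> B] by (simp add: Sigma0_def)
qed

lemma Sigma0_ge_1: "A \<in> Sigma0 \<xi> \<Longrightarrow> 1 \<le> \<xi>"
  unfolding Sigma0_def mem_Collect_eq by (erule is_Sigma0.cases) simp_all

text \<open>Above level 1 a decomposition for \<open>\<xi>\<close> serves unchanged for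
  \<open>\<eta>\<close>. Leaving level 1 needs topology: an open set is a countable union of closed
  sets because clopen cylinders form a countable base.\<close>

lemma Sigma0_mono:
  assumes "\<xi> \<le> \<eta>"
  shows "Sigma0 \<xi> \<subseteq> (Sigma0 \<eta> :: baire set set)"
proof
  fix A :: "baire set"
  assume A: "A \<in> Sigma0 \<xi>"
  consider "\<xi> = \<eta>" | "\<xi> = 1" "1 < \<eta>" | "1 < \<xi>" "1 < \<eta>"
    using assms Sigma0_ge_1[OF A] by force
  then show "A \<in> Sigma0 \<eta>"
  proof cases
    case 2
    then have "open A" using A by (simp add: Sigma0_1)
    then obtain c :: "nat \<Rightarrow> baire set" where "\<And>n. closed (c n)" "A = (\<Union>n. c n)"
      using open_eq_UN_clopen by metis
    then show ?thesis
      unfolding Sigma0_iff[OF 2(2)] using 2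
      by (intro exI[of _ c]) (auto simp: Sigma0_1 closed_def)
  next
    case 3
    obtain B where "A = (\<Union>n::nat. B n)" "\<forall>n. \<exists>\<theta>. 1 \<le> \<theta> \<and> \<theta> < \<xi> \<and> - B n \<in> Sigma0 \<theta>"
      using A unfolding Sigma0_iff[OF 3(1)] by blast
    then show ?thesis
      unfolding Sigma0_iff[OF 3(2)] using assms by (intro exI[of _ B]) (meson less_le_trans)
  qed (use A in simp)
qed

lemma Sigma0_UN:
  fixes A :: "nat \<Rightarrow> 'a::topological_space set"
  assumes "\<And>n. A n \<in> Sigma0 \<xi>"
  shows "(\<Union>n. A n) \<in> Sigma0 \<xi>"
proof (cases "\<xi> = 1")
  case True
  then show ?thesis using assms by (auto simp: Sigma0_1)
next
  case False
  then have \<xi>: "1 < \<xi>" using Sigma0_ge_1[OF assms] by force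
  from assms have "\<forall>n. \<exists>B. A n = (\<Union>m::nat. B m) \<and>
      (\<forall>m. \<exists>\<eta>. 1 \<le> \<eta> \<and> \<eta> < \<xi> \<and> - B m \<in> Sigma0 \<eta>)"
    by (simp add: Sigma0_iff[OF \<xi>])
  then obtain B where B: "\<And>n. A n = (\<Union>m::nat. B n m)"
      "\<And>n m. \<exists>\<eta>. 1 \<le> \<eta> \<and> \<eta> < \<xi> \<and> - B n m \<in> Sigma0 \<eta>"
    by metis
  have "(\<Union>n. A n) = (\<Union>k. case_prod B (prod_decode k))" (is "_ = (\<Union>k. ?D k)")
  proof -
    have "(\<Union>k. ?D k) = (\<Union>p\<in>range prod_decode. case_prod B p)"
      by (simp add: image_image)
    then show ?thesis by (auto simp: surj_prod_decode B(1))
  qed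
  then show ?thesis
    unfolding Sigma0_iff[OF \<xi>] using B(2)
    by (intro exI[of _ ?D]) (auto split: prod.split)
qed

lemma Sigma0_Un:
  assumes "A \<in> Sigma0 \<xi>" "B \<in> Sigma0 \<xi>"
  shows "A \<union> B \<in> Sigma0 \<xi>"
proof -
  have "A \<union> B = (\<Union>n::nat. if n = 0 then A else B)"
    by (auto split: if_splits)
  also have "\<dots> \<in> Sigma0 \<xi>" by (rule Sigma0_UN) (use assms in auto)
  finally show ?thesis .
qed

lemma Sigma0_Int:
  fixes A B :: "baire set"
  assumes "A \<in> Sigma0 \<xi>" "B \<in> Sigma0 \<xi>"
  shows "A \<inter> B \<in> Sigma0 \<xi>"
proof (cases "\<xi> = 1")
  case True
  then show ?thesis using assms by (auto simp: Sigma0_1)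
next
  case False
  then have \<xi>: "1 < \<xi>" using Sigma0_ge_1[OF assms(1)] by force
  \<comment> \<open>First a single piece \<open>E\<close> of \<open>B\<close>: the levels of
    \<open>F n\<close> and \<open>E\<close> merge at their maximum, which is still below
    \<open>\<xi>\<close>.\<close>
  have *: "A \<inter> E \<in> Sigma0 \<xi>" if "1 \<le> \<eta>" "\<eta> < \<xi>" "- E \<in> Sigma0 \<eta>" for E \<eta>
  proof -
    obtain F where F: "A = (\<Union>n::nat. F n)" "\<forall>n. \<exists>\<eta>. 1 \<le> \<eta> \<and> \<eta> < \<xi> \<and> - F n \<in> Sigma0 \<eta>"
      using assms(1) unfolding Sigma0_iff[OF \<xi>] by blast
    have "\<exists>\<zeta>. 1 \<le> \<zeta> \<and> \<zeta> < \<xi> \<and> - (F n \<inter> E) \<in> Sigma0 \<zeta>" for n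
    proof -
      obtain \<theta> where \<theta>: "1 \<le> \<theta>" "\<theta> < \<xi>" "- F n \<in> Sigma0 \<theta>" using F by blast
      have "- F n \<union> - E \<in> Sigma0 (max \<theta> \<eta>)"
        using \<theta>(3) that(3) Sigma0_mono[of \<theta> "max \<theta> \<eta>"] Sigma0_mono[of \<eta> "max \<theta> \<eta>"]
        by (intro Sigma0_Un) auto
      then show ?thesis using \<theta> that by (intro exI[of _ "max \<theta> \<eta>"]) (auto simp: le_max_iff_disj)
    qed
    then show ?thesis
      unfolding Sigma0_iff[OF \<xi>] using F(1) by (intro exI[of _ "\<lambda>n. F n \<inter> E"]) auto
  qed
  obtain F where F: "B = (\<Union>n::nat. F n)" "\<forall>n. \<exists>\<eta>. 1 \<le> \<eta> \<and> \<eta> < \<xi> \<and> - F n \<in> Sigma0 \<eta>"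
    using assms(2) unfolding Sigma0_iff[OF \<xi>] by blast
  have "A \<inter> B = (\<Union>n. A \<inter> F n)" using F(1) by blast
  also have "\<dots> \<in> Sigma0 \<xi>" by (rule Sigma0_UN) (use F(2) * in blast)
  finally show ?thesis .
qed

lemma Sigma0_subset_Delta0:
  assumes "\<xi> < \<eta>"
  shows "Sigma0 \<xi> \<subseteq> (Delta0 \<eta> :: baire set set)"
proof
  fix A :: "baire set"
  assume A: "A \<in> Sigma0 \<xi>"
  then have "1 < \<eta>" "1 \<le> \<xi>" using assms Sigma0_ge_1 by force+
  then have "- A \<in> Sigma0 \<eta>"
    unfolding Sigma0_iff[OF \<open>1 < \<eta>\<close>] using A assms by (intro exI[of _ "\<lambda>_. - A"]) auto
  then show "A \<in> Delta0 \<eta>"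
    using A assms Sigma0_mono[of \<xi> \<eta>] less_imp_le[OF assms]
    by (auto simp: Delta0_def Pi0_def)
qed

lemma Delta0_Compl: "A \<in> Delta0 \<xi> \<Longrightarrow> - A \<in> Delta0 \<xi>"
  by (auto simp: Delta0_def Pi0_def)

lemma Delta0_mono: "\<xi> \<le> \<eta> \<Longrightarrow> Delta0 \<xi> \<subseteq> (Delta0 \<eta> :: baire set set)"
  using Sigma0_mono[of \<xi> \<eta>] by (auto simp: Delta0_def Pi0_def)

lemma Delta0_Int:
  fixes A B :: "baire set"
  shows "A \<in> Delta0 \<xi> \<Longrightarrow> B \<in> Delta0 \<xi> \<Longrightarrow> A \<inter> B \<in> Delta0 \<xi>"
  by (simp add: Delta0_def Pi0_def Sigma0_Int Sigma0_Un)

lemma clopen_Delta0: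
  fixes A :: "baire set"
  assumes "open A" "closed A" "1 \<le> \<xi>"
  shows "A \<in> Delta0 \<xi>"
proof -
  have "A \<in> Delta0 1" using assms by (simp add: Delta0_def Pi0_def Sigma0_1 open_Compl)
  then show ?thesis using Delta0_mono assms by blast
qed

lemma Delta0_disjointed:
  fixes q :: "nat \<Rightarrow> baire set"
  assumes "\<And>n. q n \<in> Delta0 \<xi>" "1 \<le> \<xi>"
  shows "disjointed q n \<in> Delta0 \<xi>"
proof -
  have *: "- (\<Union>i\<in>{0..<n}. q i) \<in> Delta0 \<xi>" for n
  proof (induction n)
    case 0
    then show ?case by (simp add: clopen_Delta0 assms)
  next
    case (Suc n)
    have "- (\<Union>i\<in>{0..<Suc n}. q i) = - (\<Union>i\<in>{0..<n}. q i) \<inter> - q n"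
      by (auto simp: less_Suc_eq)
    then show ?case using Suc assms by (simp add: Delta0_Int Delta0_Compl)
  qed
  show ?thesis
    unfolding disjointed_def Diff_eq by (intro Delta0_Int * assms)
qed


section \<open>Generic sequences\<close>

text \<open>One level \<open>\<xi>\<close> bounds all pieces, so that the disjointified pieces can
  act as separating sets at that level. In forcing terms the cover is a predense set.\<close>

definition below_cover :: "omega1 \<Rightarrow> (nat \<Rightarrow> baire set) \<Rightarrow> bool" where
  "below_cover l q \<longleftrightarrow> (\<Union>j. q j) = UNIV \<and> (\<exists>\<xi>. 1 \<le> \<xi> \<and> \<xi> < l \<and> (\<forall>j. q j \<in> Delta0 \<xi>))"

definition enters :: "(nat \<Rightarrow> baire set) \<Rightarrow> (nat \<Rightarrow> baire set) \<Rightarrow> bool" where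
  "enters p q \<longleftrightarrow> (\<exists>k j. p k \<subseteq> q j)"

text \<open>The point \<open>x\<close> need not lie in any \<open>p k\<close>, as these sets need
  not be closed. Whether membership of \<open>x\<close> in a set is reflected by some term is
  therefore a matter of genericity.\<close>

definition converges_to :: "(nat \<Rightarrow> baire set) \<Rightarrow> baire \<Rightarrow> bool" where
  "converges_to p x \<longleftrightarrow> decseq p \<and> (\<forall>k. p k \<noteq> {}) \<and> (\<forall>n. \<exists>k. p k \<subseteq> cylinder x n)"

definition decides_at :: "(nat \<Rightarrow> baire set) \<Rightarrow> baire \<Rightarrow> baire set \<Rightarrow> bool" where
  "decides_at p x S \<longleftrightarrow> (\<exists>k. p k \<subseteq> (if x \<in> S then S else - S))"

lemma decides_at_Compl: "decides_at p x (- S) \<longleftrightarrow> decides_at p x S"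
  by (simp add: decides_at_def)

text \<open>Serves to rule out contradictory decisions: a later term is nonempty and lies in both
  sets.\<close>

lemma converges_to_compatible:
  assumes "converges_to p x" "p i \<subseteq> S" "p j \<subseteq> T"
  shows "S \<inter> T \<noteq> {}"
proof -
  have "p (max i j) \<subseteq> p i" "p (max i j) \<subseteq> p j" "p (max i j) \<noteq> {}"
    using assms(1) decseqD[of p _ "max i j"] by (simp_all add: converges_to_def)
  with assms show ?thesis by blast
qed

lemma decides_at_clopen:
  assumes "converges_to p x" "open S" "closed S"
  shows "decides_at p x S"
proof -
  have "open (if x \<in> S then S else - S)" using assms by auto
  then obtain n where "cylinder x n \<subseteq> (if x \<in> S then S else - S)"
    using open_contains_cylinder[of "if x \<in> S then S else - S" x]
    by (metis Compl_iff)
  then show ?thesis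
    using assms(1) unfolding converges_to_def decides_at_def by (meson order_trans)
qed

text \<open>If \<open>x\<close> lies in some \<open>A n\<close>, the decision on that set suffices.
  Otherwise every \<open>A n\<close> is decided negatively, so by compatibility the cover cannot be
  entered through any \<open>A n\<close>; what remains is the complement, placed at index 0.\<close>

lemma decides_at_UN:
  assumes "converges_to p x" "\<And>n. decides_at p x (A n)"
    and "enters p (case_nat (- (\<Union>n. A n)) A)"
  shows "decides_at p x (\<Union>n. A n)"
proof (cases "x \<in> (\<Union>n. A n)")
  case True
  then obtain n where "x \<in> A n" by blast
  with assms(2)[of n] obtain k where "p k \<subseteq> A n" by (auto simp: decides_at_def)
  with True show ?thesis unfolding decides_at_def by fastforce
next
  case False
  obtain k j where kj: "p k \<subseteq> case_nat (- (\<Union>n. A n)) A j"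
    using assms(3) unfolding enters_def by blast
  show ?thesis
  proof (cases j)
    case 0
    with kj False show ?thesis by (auto simp: decides_at_def)
  next
    case (Suc n)
    from False assms(2)[of n] obtain i where "p i \<subseteq> - A n" by (auto simp: decides_at_def)
    with kj Suc converges_to_compatible[OF assms(1)] show ?thesis by fastforce
  qed
qed

lemma below_cover_case_nat:
  assumes "limit_ordinal l" "1 \<le> \<xi>" "\<xi> < l" "S = (\<Union>n. A n)" "S \<in> Sigma0 \<xi>"
    and "\<And>n. A n \<in> Delta0 \<xi>"
  shows "below_cover l (case_nat (- S) A)"
proof -
  \<comment> \<open>The complement of \<open>S\<close> is only \<Pi> at level \<xi>, so the common
    level moves up to \<open>\<zeta>\<close>; a limit ordinal leaves room for this.\<close>
  obtain \<zeta> where \<zeta>: "\<xi> < \<zeta>" "\<zeta> < l" using assms(1,3) by (auto simp: limit_ordinal_def)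
  have "- S \<in> Delta0 \<zeta>"
    using assms(5) Sigma0_subset_Delta0[OF \<zeta>(1)] Delta0_Compl by blast
  moreover have "A n \<in> Delta0 \<zeta>" for n
    using assms(6) Delta0_mono[of \<xi> \<zeta>] \<zeta>(1) by (meson less_imp_le subsetD)
  ultimately have "case_nat (- S) A j \<in> Delta0 \<zeta>" for j
    by (simp split: nat.split)
  moreover have "(\<Union>j. case_nat (- S) A j) = UNIV"
  proof -
    have "y \<in> (\<Union>j. case_nat (- S) A j)" for y
    proof (cases "y \<in> S")
      case True
      then obtain n where "y \<in> A n" using assms(4) by blast
      then show ?thesis by (intro UN_I[of "Suc n"]) auto
    qed (auto intro: exI[of _ 0])
    then show ?thesis by blast
  qed
  moreover have "1 \<le> \<zeta>" using assms(2) \<zeta>(1) by (rule order_trans[OF _ less_imp_le])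
  ultimately show ?thesis
    unfolding below_cover_def using \<zeta>(2) by blast
qed

text \<open>The analogue of the truth lemma of forcing.\<close>

lemma Sigma0_decided:
  fixes S :: "baire set"
  assumes "limit_ordinal l" "S \<in> Sigma0 \<xi>" "\<xi> < l"
  shows "\<exists>R. countable R \<and> (\<forall>q\<in>R. below_cover l q) \<and>
    (\<forall>p x. converges_to p x \<and> (\<forall>q\<in>R. enters p q) \<longrightarrow> decides_at p x S)"
proof -
  have "is_Sigma0 \<xi> S" using assms(2) by (simp add: Sigma0_def)
  then show ?thesis using assms(3)
  proof (induction rule: is_Sigma0.induct)
    case (base U)
    obtain c :: "nat \<Rightarrow> baire set"
      where c: "\<And>n. open (c n)" "\<And>n. closed (c n)" "U = (\<Union>n. c n)"
      using open_eq_UN_clopen[OF base(1)] by blast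
    have "below_cover l (case_nat (- U) c)"
      using below_cover_case_nat[OF assms(1) _ base(2) c(3)] base c
      by (simp add: Sigma0_1 clopen_Delta0)
    \<comment> \<open>Convergence alone decides the clopen pieces; only their union costs a
      cover.\<close>
    moreover have "decides_at p x U" if "converges_to p x" "enters p (case_nat (- U) c)" for p x
      using decides_at_UN[OF that(1) decides_at_clopen[OF that(1) c(1,2)]] that(2) c(3) by simp
    ultimately show ?case by (intro exI[of _ "{case_nat (- U) c}"]) auto
  next
    case (union \<xi> \<eta> A)
    \<comment> \<open>The induction hypothesis speaks of \<open>- A n\<close>, but deciding a set
      and deciding its complement are the same.\<close>
    have "\<exists>R. countable R \<and> (\<forall>q\<in>R. below_cover l q) \<and>
      (\<forall>p x. converges_to p x \<and> (\<forall>q\<in>R. enters p q) \<longrightarrow> decides_at p x (A n))" for n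
      using union(2)[of n] union(3) less_trans[of "\<eta> n" \<xi> l]
      by (simp add: decides_at_Compl)
    then obtain R where R: "\<And>n. countable (R n)" "\<And>n q. q \<in> R n \<Longrightarrow> below_cover l q"
      "\<And>n p x. converges_to p x \<Longrightarrow> (\<forall>q\<in>R n. enters p q) \<Longrightarrow> decides_at p x (A n)"
      by metis
    let ?S = "\<Union>n. A n"
    have "?S \<in> Sigma0 \<xi>"
      unfolding Sigma0_iff[OF union(1)] using union(2) by (auto simp: Sigma0_def)
    moreover have "A n \<in> Delta0 \<xi>" for n
      using union(2)[of n] Sigma0_subset_Delta0[of "\<eta> n" \<xi>] Delta0_Compl[of "- A n" \<xi>]
      by (auto simp: Sigma0_def)
    ultimately have q: "below_cover l (case_nat (- ?S) A)"
      using union by (intro below_cover_case_nat[OF assms(1), of \<xi>]) auto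
    have "decides_at p x ?S"
      if "converges_to p x" "\<forall>q \<in> insert (case_nat (- ?S) A) (\<Union>n. R n). enters p q" for p x
      using that by (intro decides_at_UN) (auto intro: R(3))
    with q R(1,2) show ?case
      by (intro exI[of _ "insert (case_nat (- ?S) A) (\<Union>n. R n)"]) auto
  qed
qed


section \<open>Separated unions\<close>

lemma limit_ordinal_gt_1:
  assumes "limit_ordinal l"
  shows "1 < l"
proof -
  have "0 < l" using assms omega1_zero_le[of l] by (simp add: limit_ordinal_def less_le)
  then obtain y where "0 < y" "y < l" using assms by (auto simp: limit_ordinal_def)
  then show ?thesis using omega1_one_le_iff by (metis le_less_trans)
qed

section \<open>Closure properties of \<open>Delta0 l\<close>\<close>

lemma separated_union_family_Delta0:
  assumes "limit_ordinal l"
  shows "separated_union_family l (Delta0 l :: baire set set)"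
  unfolding separated_union_family_def closed_under_separated_unions_def Sigma0_separated_def
proof (intro conjI allI impI, goal_cases)
  case (1 \<xi>)
  then show ?case using Sigma0_subset_Delta0 by blast
next
  case (2 \<xi> A)
  then obtain U where U: "\<And>n. U n \<in> Sigma0 \<xi>" "disjoint_family U" "\<And>n. A n \<subseteq> U n"
    by blast
  have U_Delta0: "W \<in> Delta0 l" if "W \<in> Sigma0 \<xi>" for W :: "baire set"
    using that Sigma0_subset_Delta0 2 by blast
  \<comment> \<open>By disjointness the complement can be computed locally: inside
    \<open>U n\<close> it is what \<open>A n\<close> misses, and outside all \<open>U n\<close> it
    is everything. The sets \<open>U n\<close> and their union lie below level \<open>l\<close>, so
    each part is in \<open>Sigma0 l\<close>.\<close>
  have "- (\<Union>n. A n) = (\<Union>n. U n \<inter> - A n) \<union> - (\<Union>n. U n)"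
  proof
    show "(\<Union>n. U n \<inter> - A n) \<union> - (\<Union>n. U n) \<subseteq> - (\<Union>n. A n)"
    proof
      fix y assume y: "y \<in> (\<Union>n. U n \<inter> - A n) \<union> - (\<Union>n. U n)"
      show "y \<in> - (\<Union>n. A n)"
      proof
        assume "y \<in> (\<Union>n. A n)"
        then obtain n where n: "y \<in> A n" by blast
        with y U(3) obtain m where "y \<in> U m" "y \<notin> A m" by blast
        with n U(3)[of n] disjoint_family_onD[OF U(2), of m n] show False by auto
      qed
    qed
  qed auto
  moreover have "(\<Union>n. U n \<inter> - A n) \<in> Sigma0 l"
    using 2 U_Delta0[OF U(1)] by (intro Sigma0_UN Sigma0_Int) (auto simp: Delta0_def Pi0_def)
  moreover have "- (\<Union>n. U n) \<in> Sigma0 l"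
    using U_Delta0[OF Sigma0_UN[of U, OF U(1)]] by (simp add: Delta0_def Pi0_def)
  ultimately have "- (\<Union>n. A n) \<in> Sigma0 l"
    by (simp add: Sigma0_Un)
  moreover have "(\<Union>n. A n) \<in> Sigma0 l"
    using 2 by (intro Sigma0_UN) (simp add: Delta0_def)
  ultimately show ?case by (simp add: Delta0_def Pi0_def)
qed

section \<open>Minimality of \<open>Delta0 l\<close>\<close>

definition below_Delta0 :: "omega1 \<Rightarrow> baire set set" where
  "below_Delta0 l = (\<Union>\<xi>\<in>{1..<l}. Delta0 \<xi>)"

lemma below_Delta0_Int:
  assumes "A \<in> below_Delta0 l" "B \<in> below_Delta0 l"
  shows "A \<inter> B \<in> below_Delta0 l"
proof -
  obtain \<xi> \<eta> where "1 \<le> \<xi>" "\<xi> < l" "A \<in> Delta0 \<xi>" "1 \<le> \<eta>" "\<eta> < l" "B \<in> Delta0 \<eta>"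
    using assms by (auto simp: below_Delta0_def)
  then show ?thesis
    using Delta0_mono[of \<xi> "max \<xi> \<eta>"] Delta0_mono[of \<eta> "max \<xi> \<eta>"]
    by (auto simp: below_Delta0_def le_max_iff_disj intro!: bexI[of _ "max \<xi> \<eta>"] Delta0_Int)
qed

text \<open>Quantifying over the subsets \<open>W\<close> makes sense of goodness for arbitrary
  \<open>p\<close>, so no Borel level has to be tracked along a generic sequence.\<close>

definition good :: "omega1 \<Rightarrow> baire set set \<Rightarrow> baire set \<Rightarrow> baire set \<Rightarrow> bool" where
  "good l C A p \<longleftrightarrow> (\<forall>W \<in> below_Delta0 l. W \<subseteq> p \<longrightarrow> A \<inter> W \<in> C)"

lemma good_cover:
  assumes "separated_union_family l C" "below_cover l q" "\<And>j. good l C A (p \<inter> q j)"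
  shows "good l C A p"
  unfolding good_def
proof (intro ballI impI)
  fix W assume W: "W \<in> below_Delta0 l" "W \<subseteq> p"
  obtain \<xi> where q: "(\<Union>j. q j) = UNIV" "1 \<le> \<xi>" "\<xi> < l" "\<And>j. q j \<in> Delta0 \<xi>"
    using assms(2) by (auto simp: below_cover_def)
  let ?q = "disjointed q"
  have q': "?q j \<in> Delta0 \<xi>" for j
    using Delta0_disjointed q by blast
  have "A \<inter> (W \<inter> ?q j) \<in> C" for j
  proof -
    have "?q j \<in> below_Delta0 l"
      using q' q(2,3) unfolding below_Delta0_def by (intro UN_I[of \<xi>]) auto
    then have "W \<inter> ?q j \<in> below_Delta0 l"
      using W(1) by (intro below_Delta0_Int)
    moreover have "W \<inter> ?q j \<subseteq> p \<inter> q j"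
      using W disjointed_subset[of q j] by blast
    ultimately show ?thesis using assms(3) by (auto simp: good_def)
  qed
  \<comment> \<open>The separating sets are the disjointified pieces themselves, whatever the
    complexity of \<open>A\<close> and the level of \<open>W\<close>.\<close>
  moreover have "Sigma0_separated \<xi> (\<lambda>j. A \<inter> (W \<inter> ?q j))"
    unfolding Sigma0_separated_def using q'
    by (intro exI[of _ ?q]) (auto simp: Delta0_def disjoint_family_disjointed)
  moreover have "closed_under_separated_unions \<xi> C"
    using assms(1) q(2,3) by (simp add: separated_union_family_def)
  ultimately have "(\<Union>j. A \<inter> (W \<inter> ?q j)) \<in> C"
    unfolding closed_under_separated_unions_def by (simp only: simp_thms)
  moreover have "(\<Union>j. A \<inter> (W \<inter> ?q j)) = A \<inter> W"
    using UN_disjointed_eq[of q] q(1) by (simp flip: Int_UN_distrib)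
  ultimately show "A \<inter> W \<in> C" by simp
qed

lemma bad_generic_sequence:
  assumes "limit_ordinal l" "separated_union_family l C" "\<not> good l C A UNIV"
    and "countable R" "\<And>q. q \<in> R \<Longrightarrow> below_cover l q"
  obtains p x where "converges_to p x" "\<forall>q\<in>R. enters p q" "\<forall>k. \<not> good l C A (p k)"
proof -
  \<comment> \<open>Entering the clopen partition by the value at \<open>i\<close> fixes coordinate
    \<open>i\<close> of the limit point.\<close>
  define coord :: "nat \<Rightarrow> nat \<Rightarrow> baire set" where "coord i j = {y. y i \<in> {j}}" for i j
  let ?R = "R \<union> range coord"
  define Q where "Q = from_nat_into ?R"
  have rangeQ: "range Q = ?R"
    unfolding Q_def by (intro range_from_nat_into) (use assms(4) in auto)
  have "below_cover l (coord i)" for i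
    using limit_ordinal_gt_1[OF assms(1)] clopen_Delta0[OF clopen_coordinate, of 1]
    by (auto simp only: below_cover_def coord_def intro!: exI[of _ 1])
  then have "\<forall>q\<in>range Q. below_cover l q"
    unfolding rangeQ using assms(5) by auto
  then have cover: "below_cover l (Q n)" for n by simp
  \<comment> \<open>Stage \<open>n\<close> cuts the current set by a piece of \<open>Q n\<close>; by
    \<open>good_cover\<close> some cut is again not good.\<close>
  have "\<exists>p. \<forall>n. \<not> good l C A (p n) \<and> (p (Suc n) \<subseteq> p n \<and> (\<exists>j. p (Suc n) \<subseteq> Q n j))"
  proof (rule dependent_nat_choice)
    fix P n assume "\<not> good l C A P"
    then obtain j where "\<not> good l C A (P \<inter> Q n j)"
      using good_cover[OF assms(2) cover] by blast
    then show "\<exists>P'. \<not> good l C A P' \<and> P' \<subseteq> P \<and> (\<exists>j. P' \<subseteq> Q n j)"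
      by (intro exI[of _ "P \<inter> Q n j"]) auto
  qed (use assms(3) in blast)
  then obtain p where
    "\<forall>n. \<not> good l C A (p n) \<and> (p (Suc n) \<subseteq> p n \<and> (\<exists>j. p (Suc n) \<subseteq> Q n j))" ..
  then have p: "\<forall>n. \<not> good l C A (p n)" "\<And>n. p (Suc n) \<subseteq> p n" "\<And>n. \<exists>j. p (Suc n) \<subseteq> Q n j"
    by simp_all
  have dec: "decseq p" using p(2) by (simp add: decseq_SucI)
  have "enters p (Q n)" for n
    using p(3)[of n] unfolding enters_def by blast
  then have "\<forall>q\<in>range Q. enters p q" by simp
  then have ent: "\<forall>q\<in>R. enters p q" "\<forall>i. enters p (coord i)"
    unfolding rangeQ by auto
  from ent(2) have "\<forall>i. \<exists>j k. p k \<subseteq> coord i j"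
    unfolding enters_def by blast
  then obtain x k where xk: "\<And>i. p (k i) \<subseteq> coord i (x i)"
    by metis
  \<comment> \<open>The empty set is good because \<open>{} \<in> C\<close>, so no term of the
    sequence is empty.\<close>
  have ne: "p n \<noteq> {}" for n
  proof
    assume empty: "p n = {}"
    have "{} \<in> C"
    proof -
      have "1 \<le> (1::omega1)" "1 < l" "{} \<in> Sigma0 1"
        using limit_ordinal_gt_1[OF assms(1)] by (auto simp: Sigma0_1)
      then show ?thesis
        using assms(2) unfolding separated_union_family_def by blast
    qed
    with p(1) empty show False by (metis Int_empty_right good_def subset_empty)
  qed
  have "\<exists>m. p m \<subseteq> cylinder x n" for n
  proof (induction n)
    case (Suc n)
    then obtain m where m: "p m \<subseteq> cylinder x n" by blast
    have "p (max m (k n)) \<subseteq> p m \<inter> p (k n)"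
      using decseqD[OF dec] by simp
    also have "\<dots> \<subseteq> cylinder x (Suc n)"
      using m xk[of n] by (auto simp: cylinder_def coord_def less_Suc_eq)
    finally show ?case by blast
  qed (simp add: cylinder_def)
  with dec ne have "converges_to p x" by (simp add: converges_to_def)
  from that[OF this ent(1) p(1)] show ?thesis .
qed

lemma Delta0_subset_separated_union_family:
  fixes C :: "baire set set"
  assumes "limit_ordinal l" "separated_union_family l C"
  shows "Delta0 l \<subseteq> C"
proof
  fix A :: "baire set"
  assume A: "A \<in> Delta0 l"
  note l = limit_ordinal_gt_1[OF assms(1)]
  have below: "W \<in> C" if "W \<in> below_Delta0 l" for W
    using that assms(2) by (auto simp: below_Delta0_def Delta0_def separated_union_family_def)
  \<comment> \<open>\<open>Sigma0_decided\<close> stops below level \<open>l\<close>, so the pieces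
    \<open>F n\<close> are decided one by one instead of \<open>S\<close>.\<close>
  have pieces: "\<exists>F R. S = (\<Union>n::nat. F n) \<and> countable R \<and> (\<forall>q\<in>R. below_cover l q) \<and>
    (\<forall>p x. converges_to p x \<and> (\<forall>q\<in>R. enters p q) \<longrightarrow> (\<forall>n. decides_at p x (F n)))"
    if S: "S \<in> Sigma0 l" for S
  proof -
    obtain F where F: "S = (\<Union>n::nat. F n)" "\<And>n. \<exists>\<eta>. \<eta> < l \<and> - F n \<in> Sigma0 \<eta>"
      using S unfolding Sigma0_iff[OF l] by blast
    have "\<exists>R. countable R \<and> (\<forall>q\<in>R. below_cover l q) \<and>
      (\<forall>p x. converges_to p x \<and> (\<forall>q\<in>R. enters p q) \<longrightarrow> decides_at p x (F n))" for n
      using F(2)[of n] Sigma0_decided[OF assms(1), of "- F n"] by (auto simp: decides_at_Compl)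
    then obtain R where "\<And>n. countable (R n)" "\<And>n q. q \<in> R n \<Longrightarrow> below_cover l q"
      "\<And>n p x. converges_to p x \<Longrightarrow> (\<forall>q\<in>R n. enters p q) \<Longrightarrow> decides_at p x (F n)"
      by metis
    then show ?thesis using F(1) by (intro exI[of _ F] exI[of _ "\<Union>n. R n"]) auto
  qed
  have "good l C A UNIV"
  proof (rule ccontr)
    assume "\<not> good l C A UNIV"
    obtain F R where F: "A = (\<Union>n::nat. F n)" "countable R" "\<forall>q\<in>R. below_cover l q"
      "\<And>p x n. converges_to p x \<Longrightarrow> \<forall>q\<in>R. enters p q \<Longrightarrow> decides_at p x (F n)"
      using pieces[of A] A by (auto simp: Delta0_def)
    obtain G T where G: "- A = (\<Union>n::nat. G n)" "countable T" "\<forall>q\<in>T. below_cover l q"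
      "\<And>p x n. converges_to p x \<Longrightarrow> \<forall>q\<in>T. enters p q \<Longrightarrow> decides_at p x (G n)"
      using pieces[of "- A"] A by (auto simp: Delta0_def Pi0_def)
    have RT: "countable (R \<union> T)" "\<And>q. q \<in> R \<union> T \<Longrightarrow> below_cover l q"
      using F(2,3) G(2,3) by auto
    obtain p x where p: "converges_to p x" "\<forall>q\<in>R \<union> T. enters p q" "\<forall>k. \<not> good l C A (p k)"
      by (rule bad_generic_sequence[OF assms \<open>\<not> good l C A UNIV\<close> RT])
    \<comment> \<open>Whichever side contains \<open>x\<close>, some piece of that side contains it,
      and the term deciding this piece lies inside that side.\<close>
    have "\<exists>k. p k \<subseteq> A \<or> p k \<subseteq> - A"
    proof (cases "x \<in> A")
      case True
      then obtain n where "x \<in> F n" using F(1) by blast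
      with F(4)[OF p(1), of n] p(2) obtain k where "p k \<subseteq> F n" by (auto simp: decides_at_def)
      then show ?thesis using F(1) by blast
    next
      case False
      then obtain n where "x \<in> G n" using G(1) by blast
      with G(4)[OF p(1), of n] p(2) obtain k where "p k \<subseteq> G n" by (auto simp: decides_at_def)
      then show ?thesis using G(1) by blast
    qed
    then obtain k where "p k \<subseteq> A \<or> p k \<subseteq> - A" by blast
    \<comment> \<open>Inside such a term \<open>A \<inter> W\<close> is either \<open>W\<close>,
      which is in \<open>C\<close> by its low level, or empty.\<close>
    then have "good l C A (p k)"
    proof
      assume "p k \<subseteq> A"
      then have "A \<inter> W = W" if "W \<subseteq> p k" for W using that by blast
      then show ?thesis using below by (auto simp: good_def)
    next
      assume "p k \<subseteq> - A"
      then have "A \<inter> W = {}" if "W \<subseteq> p k" for W using that by blast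
      moreover have "{} \<in> C"
        using l below clopen_Delta0[of "{}" 1] by (force simp: below_Delta0_def)
      ultimately show ?thesis by (auto simp: good_def)
    qed
    with p(3) show False by blast
  qed
  \<comment> \<open>Goodness of the whole space is applied with \<open>W = UNIV\<close>.\<close>
  moreover have "UNIV \<in> below_Delta0 l"
    using l clopen_Delta0[of UNIV 1] by (force simp: below_Delta0_def)
  ultimately show "A \<in> C" by (force simp: good_def)
qed

theorem theorem3p11:
  fixes l :: omega1
  assumes "limit_ordinal l"
  shows "separated_union_family l (Delta0 l :: baire set set) \<and>
    (\<forall>C :: baire set set. separated_union_family l C \<longrightarrow> Delta0 l \<subseteq> C)"
  using separated_union_family_Delta0 Delta0_subset_separated_union_family assms by blast

end
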